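(* Let $H$ be a complex Hilbert space, let $T\in\mathcal{B}(H)$, let $T=V|T|$ be the polar decomposition of $T$, and suppose that $\ker(T^* )\subseteq\ker(T)$. Consider the following statements: (1) $T$ is semi-co-hyponormal; (2) $V|T|V^*\geq |T|\geq V^*|T|V$; (3) $\tilde{T}$ is semi-co-hyponormal; (4) $M(T)$ is semi-co-hyponormal; (5) $V|T|V^*\geq V^*|T|V$; (6) $\Delta(T)$ is co-hyponormal. Then $$(1)\iff(2)\iff(3)\implies(4)\iff(5)\implies(6).$$ If moreover $\ker(T^* )=\ker(T)$, then $(6)\implies(5)$.
   Context: $\mathcal{B}(H)$ is the algebra of bounded linear operators on $H$. For $T\in\mathcal{B}(H)$, $|T|=(T^*T)^{1/2}$, and the polar decomposition $T=V|T|$ is the canonical one: $V$ is the unique partial isometry with $T=V|T|$ and $\ker(V)=\ker(T)$. Associated with $T=V|T|$ are the Duggal transform $\tilde{T}=|T|V$, the mean transform $M(T)=\frac12(T+|T|V)$, and the Aluthge transform $\Delta(T)=|T|^{1/2}V|T|^{1/2}$. An operator $A\in\mathcal{B}(H)$ is co-hyponormal if $A^*A\leq AA^*$, and semi-co-hyponormal if $(A^*A)^{1/2}\leq (AA^* )^{1/2}$, i.e. $|A|\leq|A^*|$. Inequalities between self-adjoint operators are in the usual (positive semidefinite) order. *)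

theory Defs
  imports "HOL-Analysis.Analysis"
begin

text \<open>
  Complex Hilbert spaces are built on top of the real Hilbert spaces of the library: the norm,
  the topology and completeness are those of the underlying real inner product space, whose inner
  product is the real part of the complex one. Positive definiteness of \<open>cinner\<close>
  and \<open>norm x = sqrt (Re (cinner x x))\<close> therefore follow from \<open>inner_eq_Re_cinner\<close>.
  The complex inner product is linear in its first argument.
\<close>

class chilbert_space = real_inner + complete_space +
  fixes scaleC :: "complex \<Rightarrow> 'a \<Rightarrow> 'a" (infixr "*\<^sub>C" 75)
    and cinner :: "'a \<Rightarrow> 'a \<Rightarrow> complex"
  assumes scaleC_add_right: "c *\<^sub>C (x + y) = c *\<^sub>C x + c *\<^sub>C y"
    and scaleC_add_left: "(c + d) *\<^sub>C x = c *\<^sub>C x + d *\<^sub>C x"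
    and scaleC_scaleC: "c *\<^sub>C d *\<^sub>C x = (c * d) *\<^sub>C x"
    and scaleC_one: "1 *\<^sub>C x = x"
    and scaleR_scaleC: "r *\<^sub>R x = complex_of_real r *\<^sub>C x"
    and cinner_commute: "cinner x y = cnj (cinner y x)"
    and cinner_add_left: "cinner (x + y) z = cinner x z + cinner y z"
    and cinner_scaleC_left: "cinner (c *\<^sub>C x) y = c * cinner x y"
    and inner_eq_Re_cinner: "inner x y = Re (cinner x y)"

instantiation complex :: chilbert_space
begin

definition "scaleC_complex (c :: complex) (x :: complex) = c * x"
definition "cinner_complex (x :: complex) (y :: complex) = x * cnj y"

instance
  by standard
    (auto simp: scaleC_complex_def cinner_complex_def algebra_simps scaleR_conv_of_real
      inner_complex_def)

end

text \<open>
  The library type \<open>'a \<Rightarrow>\<^sub>L 'a\<close> consists of the bounded real-linear maps; the elements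
  of B(H) are those that also commute with complex scalars.
\<close>

definition clinear_op :: "('a::chilbert_space \<Rightarrow>\<^sub>L 'a) \<Rightarrow> bool" where
  "clinear_op A \<longleftrightarrow> (\<forall>c x. blinfun_apply A (c *\<^sub>C x) = c *\<^sub>C blinfun_apply A x)"

definition op_ker :: "('a::chilbert_space \<Rightarrow>\<^sub>L 'a) \<Rightarrow> 'a set" where
  "op_ker A = {x. blinfun_apply A x = 0}"

definition adj :: "('a::chilbert_space \<Rightarrow>\<^sub>L 'a) \<Rightarrow> ('a \<Rightarrow>\<^sub>L 'a)" where
  "adj A = (THE B. \<forall>x y. cinner (blinfun_apply A x) y = cinner x (blinfun_apply B y))"

definition positive_op :: "('a::chilbert_space \<Rightarrow>\<^sub>L 'a) \<Rightarrow> bool" where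
  "positive_op A \<longleftrightarrow> clinear_op A \<and> (\<forall>x. cinner (blinfun_apply A x) x \<in> \<real>\<^sub>\<ge>\<^sub>0)"

definition op_le :: "('a::chilbert_space \<Rightarrow>\<^sub>L 'a) \<Rightarrow> ('a \<Rightarrow>\<^sub>L 'a) \<Rightarrow> bool"
    (infix "\<preceq>" 50) where
  "A \<preceq> B \<longleftrightarrow> positive_op (B - A)"

text \<open>The positive square root; meaningful for positive \<open>A\<close>.\<close>

definition op_sqrt :: "('a::chilbert_space \<Rightarrow>\<^sub>L 'a) \<Rightarrow> ('a \<Rightarrow>\<^sub>L 'a)" where
  "op_sqrt A = (THE S. positive_op S \<and> S o\<^sub>L S = A)"

definition op_abs :: "('a::chilbert_space \<Rightarrow>\<^sub>L 'a) \<Rightarrow> ('a \<Rightarrow>\<^sub>L 'a)" where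
  "op_abs A = op_sqrt (adj A o\<^sub>L A)"

text \<open>A partial isometry is isometric on the orthogonal complement of its kernel.\<close>

definition partial_isometry :: "('a::chilbert_space \<Rightarrow>\<^sub>L 'a) \<Rightarrow> bool" where
  "partial_isometry V \<longleftrightarrow> clinear_op V \<and>
    (\<forall>x. (\<forall>z\<in>op_ker V. cinner x z = 0) \<longrightarrow> norm (blinfun_apply V x) = norm x)"

definition polar_decomposition ::
    "('a::chilbert_space \<Rightarrow>\<^sub>L 'a) \<Rightarrow> ('a \<Rightarrow>\<^sub>L 'a) \<Rightarrow> bool" where
  "polar_decomposition T V \<longleftrightarrow>
    partial_isometry V \<and> T = V o\<^sub>L op_abs T \<and> op_ker V = op_ker T"

text \<open>In the transforms, \<open>V\<close> is the partial isometry of the polar decomposition of \<open>T\<close>.\<close>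

definition duggal_transform ::
    "('a::chilbert_space \<Rightarrow>\<^sub>L 'a) \<Rightarrow> ('a \<Rightarrow>\<^sub>L 'a) \<Rightarrow> ('a \<Rightarrow>\<^sub>L 'a)" where
  "duggal_transform T V = op_abs T o\<^sub>L V"

definition mean_transform ::
    "('a::chilbert_space \<Rightarrow>\<^sub>L 'a) \<Rightarrow> ('a \<Rightarrow>\<^sub>L 'a) \<Rightarrow> ('a \<Rightarrow>\<^sub>L 'a)" where
  "mean_transform T V = (1/2) *\<^sub>R (T + (op_abs T o\<^sub>L V))"

definition aluthge_transform ::
    "('a::chilbert_space \<Rightarrow>\<^sub>L 'a) \<Rightarrow> ('a \<Rightarrow>\<^sub>L 'a) \<Rightarrow> ('a \<Rightarrow>\<^sub>L 'a)" where
  "aluthge_transform T V = op_sqrt (op_abs T) o\<^sub>L V o\<^sub>L op_sqrt (op_abs T)"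

definition co_hyponormal :: "('a::chilbert_space \<Rightarrow>\<^sub>L 'a) \<Rightarrow> bool" where
  "co_hyponormal A \<longleftrightarrow> adj A o\<^sub>L A \<preceq> A o\<^sub>L adj A"

definition semi_co_hyponormal :: "('a::chilbert_space \<Rightarrow>\<^sub>L 'a) \<Rightarrow> bool" where
  "semi_co_hyponormal A \<longleftrightarrow> op_sqrt (adj A o\<^sub>L A) \<preceq> op_sqrt (A o\<^sub>L adj A)"

end

theory Submission
  imports Defs
begin

text \<open>
  Write \<open>P\<close> for the modulus of \<open>T\<close>, \<open>Q = V\<^sup>* P V\<close> and \<open>R = V P V\<^sup>*\<close>. The polar
  decomposition gives \<open>V\<^sup>* V P = P\<close>, and the inclusion of the kernels gives
  \<open>V V\<^sup>* P = P\<close> (\<open>polar_factors_polar_decomposition\<close>). With these two cancellations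
  the moduli of all operators involved, and of their adjoints, are explicit:
  \<open>P\<close> and \<open>R\<close> for \<open>T\<close>, \<open>Q\<close> and \<open>P\<close> for the Duggal transform, and
  \<open>(P + Q) / 2\<close> and \<open>(P + R) / 2\<close> for the mean transform, because the squares agree and
  positive square roots are unique. Therefore semi-co-hyponormality of \<open>T\<close>, of the Duggal
  transform and of the mean transform says, respectively, \<open>P \<preceq> R\<close>, \<open>Q \<preceq> P\<close> and
  \<open>Q \<preceq> R\<close>. Conjugation by \<open>V\<close> and by \<open>V\<^sup>*\<close> shows
  that the first two are equivalent (\<open>op_le_R_iff\<close>), and transitivity gives the third.

  For the Aluthge transform and \<open>S\<close> the root of \<open>P\<close>, co-hyponormality says
  \<open>S Q S \<preceq> S R S\<close>, which follows from \<open>Q \<preceq> R\<close> by conjugation. Conversely it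
  compares \<open>Q\<close> and \<open>R\<close> on the closure of the range of \<open>S\<close>; if the kernels of \<open>T\<close> and
  \<open>T\<^sup>*\<close> coincide, both operators vanish on the orthogonal complement
  (\<open>co_hyponormal_aluthgeD\<close>).

  The underlying operator theory is developed for bounded real-linear maps on real Hilbert spaces:
  the Riesz representation theorem by minimisation, which yields projections and adjoints, and
  existence and uniqueness of positive square roots by a norm-convergent iteration. It transfers to
  complex Hilbert spaces because, for complex-linear maps, being adjoint and being positive can be
  tested with the real part of the inner product alone (\<open>adj_eqI\<close>,
  \<open>positive_op_iff_psd\<close>).
\<close>

section \<open>Riesz representation, projections and adjoints\<close>

text \<open>
  The representing vector is the minimiser of \<open>x \<bullet> x - 2 * f x\<close> on \<open>S\<close>. A closed subspace
  instead of the whole space lets the same minimisation give both orthogonal projections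
  (\<open>f\<close> an inner product with a fixed vector) and adjoints (\<open>S = UNIV\<close>).
\<close>

lemma riesz_on_closed_subspace:
  fixes f :: "'a::{real_inner,banach} \<Rightarrow> real"
  assumes f: "bounded_linear f" and S: "subspace S" "closed S"
  shows "\<exists>x\<in>S. \<forall>y\<in>S. x \<bullet> y = f y"
proof -
  interpret f: bounded_linear f by fact
  define q where "q x = x \<bullet> x - 2 * f x" for x
  obtain K where K: "\<And>x. \<bar>f x\<bar> \<le> norm x * K"
    using f.bounded by auto
  have q_lower: "- K\<^sup>2 \<le> q x" for x
  proof -
    have "0 \<le> (norm x - K)\<^sup>2" by simp
    then show ?thesis
      using K[of x] by (simp add: q_def power2_norm_eq_inner[symmetric] power2_diff algebra_simps abs_le_iff)
  qed
  define m where "m = Inf (q ` S)"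
  have bdd: "bdd_below (q ` S)" using q_lower by (rule bdd_belowI2)
  have m_le: "m \<le> q x" if "x \<in> S" for x
    unfolding m_def using bdd that by (simp add: cInf_lower)
  have "\<exists>x\<in>S. q x < m + inverse (real (Suc n))" for n
  proof -
    have "q ` S \<noteq> {}" using subspace_0[OF S(1)] by auto
    moreover have "Inf (q ` S) < m + inverse (real (Suc n))" by (simp add: m_def)
    ultimately obtain v where "v \<in> q ` S" "v < m + inverse (real (Suc n))"
      using cInf_lessD by meson
    then show ?thesis by auto
  qed
  then obtain X where XS: "\<And>n. X n \<in> S" and Xq: "\<And>n. q (X n) < m + inverse (real (Suc n))"
    by metis
  \<comment> \<open>The parallelogram law makes \<open>q\<close> uniformly convex, so that near-minimisers are close.\<close>
  have close: "(norm (x - y))\<^sup>2 \<le> 2 * (q x - m) + 2 * (q y - m)" if "x \<in> S" "y \<in> S" for x y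
  proof -
    have "m \<le> q ((1/2) *\<^sub>R (x + y))"
      by (intro m_le subspace_scale subspace_add S that)
    also have "q ((1/2) *\<^sub>R (x + y)) = q x / 2 + q y / 2 - (norm (x - y))\<^sup>2 / 4"
      by (simp add: q_def power2_norm_eq_inner inner_add inner_diff f.add f.scaleR
          inner_commute field_simps)
    finally show ?thesis by simp
  qed
  have "Cauchy X"
  proof (rule metric_CauchyI)
    fix e :: real assume "e > 0"
    then have "e\<^sup>2 / 4 > 0" by simp
    then obtain N where N: "inverse (real (Suc N)) < e\<^sup>2 / 4"
      using reals_Archimedean by blast
    have small: "q (X n) - m < e\<^sup>2 / 4" if "n \<ge> N" for n
    proof -
      have "inverse (real (Suc n)) \<le> inverse (real (Suc N))" using that by (simp add: field_simps)
      then show ?thesis using Xq[of n] N by linarith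
    qed
    have "dist (X i) (X j) < e" if "i \<ge> N" "j \<ge> N" for i j
    proof -
      have "(norm (X i - X j))\<^sup>2 < e\<^sup>2"
        using close[OF XS XS, of i j] small[OF that(1)] small[OF that(2)] by (simp add: field_simps)
      then show ?thesis using \<open>e > 0\<close> by (simp add: dist_norm power2_less_imp_less)
    qed
    then show "\<exists>M. \<forall>i\<ge>M. \<forall>j\<ge>M. dist (X i) (X j) < e" by blast
  qed
  then obtain x where lim: "X \<longlonglongrightarrow> x" using Cauchy_convergent_iff convergent_def by blast
  have xS: "x \<in> S" using closed_sequentially[OF S(2)] XS lim by blast
  have "(\<lambda>n. q (X n)) \<longlonglongrightarrow> q x"
    unfolding q_def by (intro tendsto_intros lim f.tendsto)
  moreover have "(\<lambda>n. m + inverse (real (Suc n))) \<longlonglongrightarrow> m + 0"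
    by (intro tendsto_intros LIMSEQ_inverse_real_of_nat)
  ultimately have "q x \<le> m + 0"
    by (rule LIMSEQ_le) (use Xq in \<open>auto intro: less_imp_le\<close>)
  have "x \<bullet> y = f y" if y: "y \<in> S" for y
  proof (cases "y = 0")
    case True then show ?thesis by (simp add: f.zero)
  next
    case False
    define t where "t = (f y - x \<bullet> y) / (y \<bullet> y)"
    have "q x \<le> q (x + t *\<^sub>R y)"
      using \<open>q x \<le> m + 0\<close> m_le[of "x + t *\<^sub>R y"] S(1) xS y
      by (simp add: subspace_add subspace_scale)
    also have "q (x + t *\<^sub>R y) = q x + t * (t * (y \<bullet> y) - 2 * (f y - x \<bullet> y))"
      by (simp add: q_def inner_add f.add f.scaleR inner_commute algebra_simps)
    also have "t * (y \<bullet> y) = f y - x \<bullet> y" using False by (simp add: t_def)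
    finally have "0 \<le> - (t * (f y - x \<bullet> y))" by (simp add: algebra_simps)
    also have "t * (f y - x \<bullet> y) = (f y - x \<bullet> y)\<^sup>2 / (y \<bullet> y)"
      by (simp add: t_def power2_eq_square)
    finally have "(f y - x \<bullet> y)\<^sup>2 / (y \<bullet> y) \<le> 0" by simp
    moreover have "y \<bullet> y > 0" using False by simp
    ultimately have "(f y - x \<bullet> y)\<^sup>2 \<le> 0" by (simp add: divide_le_0_iff)
    then show ?thesis by simp
  qed
  then show ?thesis using xS by blast
qed

lemma orthogonal_projection_exists:
  fixes S :: "'a::{real_inner,banach} set"
  assumes "subspace S" "closed S"
  obtains u w where "x = u + w" "u \<in> S" "\<And>y. y \<in> S \<Longrightarrow> w \<bullet> y = 0"
proof -
  obtain u where "u \<in> S" "\<forall>y\<in>S. u \<bullet> y = x \<bullet> y"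
    using riesz_on_closed_subspace[OF bounded_linear_inner_right assms] by blast
  then show thesis using that[of u "x - u"] by (simp add: inner_diff)
qed

lemma subspace_closure:
  fixes M :: "'a::real_normed_vector set"
  assumes "subspace M"
  shows "subspace (closure M)"
  unfolding subspace_def
proof (intro conjI ballI allI)
  show "0 \<in> closure M" using subspace_0[OF assms] closure_subset by blast
next
  fix x y assume "x \<in> closure M" "y \<in> closure M"
  then obtain X Y where "\<And>n. X n \<in> M" "X \<longlonglongrightarrow> x" "\<And>n. Y n \<in> M" "Y \<longlonglongrightarrow> y"
    unfolding closure_sequential by blast
  then show "x + y \<in> closure M"
    unfolding closure_sequential
    by (intro exI[of _ "\<lambda>n. X n + Y n"]) (auto intro: subspace_add[OF assms] tendsto_add)
next
  fix r x assume "x \<in> closure M"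
  then obtain X where "\<And>n. X n \<in> M" "X \<longlonglongrightarrow> x"
    unfolding closure_sequential by blast
  then show "r *\<^sub>R x \<in> closure M"
    unfolding closure_sequential
    by (intro exI[of _ "\<lambda>n. r *\<^sub>R X n"])
      (auto intro: subspace_scale[OF assms] tendsto_intros)
qed

lemma real_adjoint_exists:
  fixes A :: "'a::{real_inner,banach} \<Rightarrow>\<^sub>L 'a"
  shows "\<exists>B :: 'a \<Rightarrow>\<^sub>L 'a. \<forall>x y. A x \<bullet> y = x \<bullet> B y"
proof -
  have "\<exists>b. \<forall>x. b \<bullet> x = A x \<bullet> y" for y
  proof -
    have "bounded_linear (\<lambda>x. A x \<bullet> y)"
      by (intro bounded_linear_compose[OF bounded_linear_inner_left] blinfun.bounded_linear_right)
    then show ?thesis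
      using riesz_on_closed_subspace[of "\<lambda>x. A x \<bullet> y" UNIV] by auto
  qed
  then obtain b where b: "\<And>x y. b y \<bullet> x = A x \<bullet> y" by metis
  have "bounded_linear b"
  proof (rule bounded_linear_intro[of _ "norm A"])
    show "b (x + y) = b x + b y" for x y
      by (rule vector_eq_rdot[THEN iffD1]) (simp add: b inner_add)
    show "b (r *\<^sub>R x) = r *\<^sub>R b x" for r x
      by (rule vector_eq_rdot[THEN iffD1]) (simp add: b)
    show "norm (b x) \<le> norm x * norm A" for x
    proof (cases "b x = 0")
      case False
      have "norm (b x) * norm (b x) = A (b x) \<bullet> x"
        by (simp add: b[symmetric] dot_square_norm power2_eq_square)
      also have "\<dots> \<le> norm (A (b x)) * norm x" by (rule norm_cauchy_schwarz)
      also have "\<dots> \<le> norm A * norm (b x) * norm x"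
        by (intro mult_right_mono norm_blinfun) simp
      finally have "norm (b x) * norm (b x) \<le> norm (b x) * (norm x * norm A)"
        by (simp add: ac_simps)
      then show ?thesis using False by simp
    qed simp
  qed
  then show ?thesis
    by (intro exI[of _ "Blinfun b"]) (metis b bounded_linear_Blinfun_apply inner_commute)
qed

section \<open>Square roots of positive operators\<close>

text \<open>
  Square roots are constructed on real Hilbert spaces, where positivity has to include symmetry.
\<close>

definition psd :: "('a::real_inner \<Rightarrow>\<^sub>L 'a) \<Rightarrow> bool" where
  "psd A \<longleftrightarrow> (\<forall>x y. A x \<bullet> y = x \<bullet> A y) \<and> (\<forall>x. 0 \<le> A x \<bullet> x)"

lemma psd_symmetric: "psd A \<Longrightarrow> A x \<bullet> y = x \<bullet> A y"
  and psd_nonneg: "psd A \<Longrightarrow> 0 \<le> A x \<bullet> x"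
  unfolding psd_def by blast+

text \<open>
  The form of \<open>A\<close> is nonnegative at \<open>c *\<^sub>R x - A x\<close>; expanding this and bounding the
  cubic term by \<open>norm A \<le> c\<close> leaves the claim.
\<close>

lemma psd_norm_bound:
  assumes A: "psd A" and c: "norm A \<le> c" "0 < c"
  shows "A x \<bullet> A x \<le> c * (A x \<bullet> x)"
proof -
  have "A (A x) \<bullet> A x \<le> norm (A (A x)) * norm (A x)" by (rule norm_cauchy_schwarz)
  also have "\<dots> \<le> (c * norm (A x)) * norm (A x)"
    by (meson c(1) mult_right_mono norm_blinfun norm_ge_zero order_trans)
  finally have le: "A (A x) \<bullet> A x \<le> c * (A x \<bullet> A x)"
    by (simp add: dot_square_norm power2_eq_square)
  have "0 \<le> A (c *\<^sub>R x - A x) \<bullet> (c *\<^sub>R x - A x)" by (rule psd_nonneg[OF A])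
  also have "\<dots> = c * (c * (A x \<bullet> x)) - 2 * c * (A x \<bullet> A x) + A (A x) \<bullet> A x"
    using psd_symmetric[OF A, of "A x" x]
    by (simp add: blinfun.diff_right blinfun.scaleR_right inner_diff algebra_simps inner_commute)
  also have "\<dots> \<le> c * (c * (A x \<bullet> x) - A x \<bullet> A x)" using le by (simp add: algebra_simps)
  finally show ?thesis using c(2) by (simp add: zero_le_mult_iff)
qed

lemma psd_kernel:
  assumes "psd A" "A x \<bullet> x = 0"
  shows "A x = 0"
proof -
  have "A x \<bullet> A x \<le> (norm A + 1) * (A x \<bullet> x)"
    by (rule psd_norm_bound[OF assms(1)]) (auto intro: add_nonneg_pos)
  then have "A x \<bullet> A x = 0" using assms(2) inner_ge_zero[of "A x"] by simp
  then show ?thesis by simp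
qed

text \<open>
  A fixed point \<open>X\<close> of the iteration satisfies \<open>(1 - X)\<^sup>2 = 1 - B\<close>, so \<open>1 - X\<close> is a
  square root of \<open>1 - B\<close>.
\<close>

fun sqrt_iter :: "('a::real_normed_vector \<Rightarrow>\<^sub>L 'a) \<Rightarrow> nat \<Rightarrow> 'a \<Rightarrow>\<^sub>L 'a" where
  "sqrt_iter B 0 = 0"
| "sqrt_iter B (Suc n) = (1/2) *\<^sub>R (B + (sqrt_iter B n o\<^sub>L sqrt_iter B n))"

text \<open>
  This is the same iteration for the scalar \<open>B = 1\<close>. Every iterate is a polynomial in \<open>B\<close>
  with nonnegative coefficients, and so is every difference of consecutive iterates; hence for
  \<open>norm B \<le> 1\<close> the scalar iteration dominates the operator iteration.
\<close>

fun majorant_iter :: "nat \<Rightarrow> real" where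
  "majorant_iter 0 = 0"
| "majorant_iter (Suc n) = (1 + (majorant_iter n)\<^sup>2) / 2"

lemma majorant_iter_bounds: "0 \<le> majorant_iter n" "majorant_iter n \<le> 1"
proof -
  have "0 \<le> majorant_iter n \<and> majorant_iter n \<le> 1"
  proof (induction n)
    case (Suc n)
    then have "(majorant_iter n)\<^sup>2 \<le> 1" by (simp add: power_le_one)
    then show ?case by simp
  qed simp
  then show "0 \<le> majorant_iter n" "majorant_iter n \<le> 1" by auto
qed

lemma sqrt_iter_commute:
  assumes "C o\<^sub>L B = B o\<^sub>L C"
  shows "C o\<^sub>L sqrt_iter B n = sqrt_iter B n o\<^sub>L C"
proof (rule blinfun_eqI, induction n)
  case (Suc n)
  have "C (B x) = B (C x)" for x
    using assms by (metis blinfun_apply_blinfun_compose)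
  moreover have "C (sqrt_iter B n x) = sqrt_iter B n (C x)" for x
    using Suc by simp
  ultimately show ?case
    by (simp add: blinfun.add_left blinfun.scaleR_left blinfun.scaleR_right blinfun.add_right)
qed simp

lemma sqrt_iter_symmetric:
  fixes B :: "'a::real_inner \<Rightarrow>\<^sub>L 'a"
  assumes "\<And>x y. B x \<bullet> y = x \<bullet> B y"
  shows "sqrt_iter B n x \<bullet> y = x \<bullet> sqrt_iter B n y"
  by (induction n arbitrary: x y)
    (simp_all add: assms blinfun.add_left blinfun.scaleR_left inner_add)

lemma norm_sqrt_iter:
  assumes "norm B \<le> 1"
  shows "norm (sqrt_iter B n) \<le> majorant_iter n"
proof (induction n)
  case (Suc n)
  have "norm (sqrt_iter B (Suc n)) \<le> (norm B + norm (sqrt_iter B n o\<^sub>L sqrt_iter B n)) / 2"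
    using norm_triangle_ineq[of B "sqrt_iter B n o\<^sub>L sqrt_iter B n"] by simp
  also have "norm (sqrt_iter B n o\<^sub>L sqrt_iter B n) \<le> norm (sqrt_iter B n) * norm (sqrt_iter B n)"
    by (rule norm_blinfun_compose)
  also have "\<dots> \<le> majorant_iter n * majorant_iter n"
    by (intro mult_mono Suc) (auto simp: majorant_iter_bounds)
  finally show ?case using assms by (simp add: power2_eq_square)
qed simp

text \<open>
  Consecutive iterates \<open>X\<close>, \<open>Y\<close> commute, so that
  \<open>Y\<^sup>2 - X\<^sup>2 = (Y + X)(Y - X)\<close>, as for the scalars.
\<close>

lemma norm_sqrt_iter_diff:
  assumes B: "norm B \<le> 1"
  shows "norm (sqrt_iter B (Suc n) - sqrt_iter B n) \<le> majorant_iter (Suc n) - majorant_iter n"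
proof (induction n)
  case 0
  show ?case using B by (simp add: zero_blinfun_def[symmetric])
next
  case (Suc n)
  let ?X = "sqrt_iter B n" and ?Y = "sqrt_iter B (Suc n)"
  have comm: "?Y (?X x) = ?X (?Y x)" for x
  proof -
    have "?X o\<^sub>L B = B o\<^sub>L ?X" by (rule sqrt_iter_commute[symmetric]) simp
    from sqrt_iter_commute[OF this, of "Suc n"] show ?thesis
      by (metis blinfun_apply_blinfun_compose)
  qed
  have "sqrt_iter B (Suc (Suc n)) - ?Y = (1/2) *\<^sub>R ((?Y + ?X) o\<^sub>L (?Y - ?X))"
  proof (rule blinfun_eqI)
    fix x
    have "sqrt_iter B (Suc (Suc n)) x - ?Y x = (1/2) *\<^sub>R (?Y (?Y x) - ?X (?X x))"
      by (simp add: blinfun.add_left blinfun.scaleR_left algebra_simps)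
    also have "\<dots> = (1/2) *\<^sub>R (?Y (?Y x - ?X x) + ?X (?Y x - ?X x))"
      by (simp only: blinfun.diff_right comm) simp
    finally show "(sqrt_iter B (Suc (Suc n)) - ?Y) x = ((1/2) *\<^sub>R ((?Y + ?X) o\<^sub>L (?Y - ?X))) x"
      by (simp add: blinfun.add_left blinfun.diff_left blinfun.scaleR_left del: sqrt_iter.simps)
  qed
  then have "norm (sqrt_iter B (Suc (Suc n)) - ?Y) = norm ((?Y + ?X) o\<^sub>L (?Y - ?X)) / 2"
    by simp
  also have "\<dots> \<le> norm (?Y + ?X) * norm (?Y - ?X) / 2"
    using norm_blinfun_compose by (intro divide_right_mono) auto
  also have "\<dots> \<le> (majorant_iter (Suc n) + majorant_iter n) * (majorant_iter (Suc n) - majorant_iter n) / 2"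
    using norm_triangle_mono[OF norm_sqrt_iter[OF B, of "Suc n"] norm_sqrt_iter[OF B, of n]]
    by (intro divide_right_mono mult_mono Suc)
      (auto simp: majorant_iter_bounds simp del: majorant_iter.simps sqrt_iter.simps)
  also have "\<dots> = majorant_iter (Suc (Suc n)) - majorant_iter (Suc n)"
    by (simp add: power2_eq_square field_simps)
  finally show ?case .
qed

text \<open>
  The scalar iterates increase and are bounded by 1, so their increments are summable; by
  domination the increments of the operator iteration are absolutely summable.
\<close>

lemma sqrt_iter_convergent:
  fixes B :: "'a::banach \<Rightarrow>\<^sub>L 'a"
  assumes B: "norm B \<le> 1"
  shows "convergent (sqrt_iter B)"
proof -
  have mono: "majorant_iter n \<le> majorant_iter (Suc n)" for n
    using norm_sqrt_iter_diff[of 0 n] norm_ge_zero[of "sqrt_iter 0 (Suc n) - sqrt_iter 0 n"]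
    by (metis diff_ge_0_iff_ge norm_zero order_trans zero_le_one)
  have "convergent majorant_iter"
    by (rule Bseq_mono_convergent)
      (auto intro!: BseqI'[of _ 1] incseq_SucI[THEN incseqD] mono simp: majorant_iter_bounds)
  then have "summable (\<lambda>n. majorant_iter (Suc n) - majorant_iter n)"
    using telescope_summable convergent_def by blast
  then have "summable (\<lambda>n. sqrt_iter B (Suc n) - sqrt_iter B n)"
    by (rule summable_comparison_test'[of _ 0]) (use norm_sqrt_iter_diff[OF B] in blast)
  then have "convergent (\<lambda>n. \<Sum>k<n. sqrt_iter B (Suc k) - sqrt_iter B k)"
    by (simp only: summable_iff_convergent)
  then show ?thesis by (simp only: sum_lessThan_telescope) simp
qed

text \<open>
  After scaling, \<open>A / c = 1 - B\<close> with \<open>norm B \<le> 1\<close>, and the root is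
  \<open>sqrt c\<close> times \<open>1 - X\<close>. As \<open>X\<close> is a limit of polynomials in \<open>A\<close>, it commutes with
  everything that commutes with \<open>A\<close>. This last conclusion has two uses: it yields uniqueness
  of the root, and, applied to multiplications by complex scalars, complex linearity of the root.
\<close>

theorem psd_sqrt_exists:
  fixes A :: "'a::{real_inner,banach} \<Rightarrow>\<^sub>L 'a"
  assumes A: "psd A"
  obtains S where "psd S" "S o\<^sub>L S = A" "\<And>C. C o\<^sub>L A = A o\<^sub>L C \<Longrightarrow> C o\<^sub>L S = S o\<^sub>L C"
proof -
  \<comment> \<open>Adding 1 keeps \<open>c\<close> positive when \<open>A\<close> is zero.\<close>
  define c where "c = norm A + 1"
  have c: "norm A \<le> c" "0 < c" by (auto simp: c_def intro: add_nonneg_pos)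
  define B where "B = id_blinfun - (1/c) *\<^sub>R A"
  have Bx: "B x = x - (1/c) *\<^sub>R A x" for x
    by (simp add: B_def blinfun.diff_left blinfun.scaleR_left)
  have normB: "norm B \<le> 1"
  proof (rule norm_blinfun_bound)
    fix x
    have "A x \<bullet> A x / c\<^sup>2 \<le> c * (A x \<bullet> x) / c\<^sup>2"
      using psd_norm_bound[OF A c] by (intro divide_right_mono) auto
    also have "\<dots> = (A x \<bullet> x) / c" using c by (simp add: power2_eq_square)
    also have "\<dots> \<le> 2 * (A x \<bullet> x) / c"
      using psd_nonneg[OF A, of x] c by (intro divide_right_mono) auto
    finally have "(norm (B x))\<^sup>2 \<le> (norm x)\<^sup>2"
      unfolding power2_norm_eq_inner Bx
      by (simp add: inner_diff inner_commute power2_eq_square)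
    from power2_le_imp_le[OF this] show "norm (B x) \<le> 1 * norm x" by simp
  qed simp
  obtain X where X: "sqrt_iter B \<longlonglongrightarrow> X"
    using sqrt_iter_convergent[OF normB] convergent_def by blast
  have Xx: "(\<lambda>n. sqrt_iter B n x) \<longlonglongrightarrow> X x" for x
    by (intro tendsto_intros X)
  have X_eq: "2 *\<^sub>R X x = B x + X (X x)" for x
  proof -
    have "(\<lambda>n. 2 *\<^sub>R sqrt_iter B (Suc n) x) \<longlonglongrightarrow> 2 *\<^sub>R X x"
      by (intro tendsto_intros X[THEN LIMSEQ_Suc])
    moreover have "(\<lambda>n. B x + sqrt_iter B n (sqrt_iter B n x)) \<longlonglongrightarrow> B x + X (X x)"
      by (intro tendsto_intros X)
    moreover have "2 *\<^sub>R sqrt_iter B (Suc n) x = B x + sqrt_iter B n (sqrt_iter B n x)" for n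
      by (simp add: blinfun.add_left blinfun.scaleR_left)
    ultimately show ?thesis using LIMSEQ_unique by (simp del: sqrt_iter.simps)
  qed
  have X_sym: "X x \<bullet> y = x \<bullet> X y" for x y
  proof -
    have "B x \<bullet> y = x \<bullet> B y" for x y
      by (simp add: Bx inner_diff psd_symmetric[OF A])
    from sqrt_iter_symmetric[OF this]
    have "(\<lambda>n. sqrt_iter B n x \<bullet> y) \<longlonglongrightarrow> x \<bullet> X y"
      by (simp add: tendsto_inner Xx)
    moreover have "(\<lambda>n. sqrt_iter B n x \<bullet> y) \<longlonglongrightarrow> X x \<bullet> y"
      by (intro tendsto_intros Xx)
    ultimately show ?thesis using LIMSEQ_unique by blast
  qed
  have normX: "norm X \<le> 1"
    by (rule LIMSEQ_le_const2[OF tendsto_norm[OF X]])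
      (use norm_sqrt_iter[OF normB] majorant_iter_bounds(2) order_trans in blast)
  define S where "S = sqrt c *\<^sub>R (id_blinfun - X)"
  have Sx: "S x = sqrt c *\<^sub>R (x - X x)" for x
    by (simp add: S_def blinfun.diff_left blinfun.scaleR_left)
  show thesis
  proof
    show "psd S"
    proof -
      have "X x \<bullet> x \<le> x \<bullet> x" for x
      proof -
        have "X x \<bullet> x \<le> norm (X x) * norm x" by (rule norm_cauchy_schwarz)
        also have "\<dots> \<le> (norm X * norm x) * norm x"
          by (intro mult_right_mono norm_blinfun) simp
        also have "\<dots> \<le> (1 * norm x) * norm x" by (intro mult_right_mono normX) auto
        finally show ?thesis by (simp add: dot_square_norm power2_eq_square)
      qed
      then show ?thesis using c by (auto simp: psd_def Sx inner_diff X_sym)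
    qed
    show "S o\<^sub>L S = A"
    proof (rule blinfun_eqI)
      fix x
      have "S (S x) = c *\<^sub>R (x - 2 *\<^sub>R X x + X (X x))"
        using c by (simp add: Sx blinfun.diff_right blinfun.scaleR_right scaleR_2 algebra_simps)
      also have "\<dots> = A x"
        using c by (simp add: X_eq Bx algebra_simps)
      finally show "(S o\<^sub>L S) x = A x" by simp
    qed
    show "C o\<^sub>L S = S o\<^sub>L C" if C: "C o\<^sub>L A = A o\<^sub>L C" for C
    proof -
      have CA: "C (A x) = A (C x)" for x using C by (metis blinfun_apply_blinfun_compose)
      have "C o\<^sub>L B = B o\<^sub>L C"
        by (rule blinfun_eqI) (simp add: Bx CA blinfun.diff_right blinfun.scaleR_right)
      from sqrt_iter_commute[OF this]
      have *: "C (sqrt_iter B n x) = sqrt_iter B n (C x)" for n x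
        by (metis blinfun_apply_blinfun_compose)
      have "C (X x) = X (C x)" for x
      proof -
        have "(\<lambda>n. C (sqrt_iter B n x)) \<longlonglongrightarrow> C (X x)" by (intro tendsto_intros X)
        moreover have "(\<lambda>n. C (sqrt_iter B n x)) \<longlonglongrightarrow> X (C x)" unfolding * by (rule Xx)
        ultimately show ?thesis using LIMSEQ_unique by blast
      qed
      then show ?thesis
        by (intro blinfun_eqI) (simp add: Sx blinfun.diff_right blinfun.scaleR_right)
    qed
  qed
qed

text \<open>
  Any root \<open>K\<close> commutes with its square, hence with the root \<open>Q\<close> constructed above. For
  \<open>y = (K - Q) x\<close> this gives \<open>(K + Q) y = 0\<close>, and positivity forces \<open>K y = Q y = 0\<close>,
  whence \<open>y\<close> is orthogonal to \<open>(K - Q) x = y\<close>.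
\<close>

theorem psd_sqrt_unique:
  fixes S R :: "'a::{real_inner,banach} \<Rightarrow>\<^sub>L 'a"
  assumes S: "psd S" and R: "psd R" and eq: "S o\<^sub>L S = R o\<^sub>L R"
  shows "S = R"
proof -
  have "psd (S o\<^sub>L S)"
    unfolding psd_def by (metis S blinfun_apply_blinfun_compose inner_ge_zero psd_symmetric)
  from psd_sqrt_exists[OF this] obtain Q where Q: "psd Q" "Q o\<^sub>L Q = S o\<^sub>L S"
    and comm: "\<And>C. C o\<^sub>L (S o\<^sub>L S) = (S o\<^sub>L S) o\<^sub>L C \<Longrightarrow> C o\<^sub>L Q = Q o\<^sub>L C"
    by blast
  have "K = Q" if K: "psd K" "K o\<^sub>L K = S o\<^sub>L S" for K
  proof (rule blinfun_eqI)
    fix x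
    have "K o\<^sub>L (S o\<^sub>L S) = (S o\<^sub>L S) o\<^sub>L K"
      by (rule blinfun_eqI) (simp flip: K(2))
    from comm[OF this] have KQ: "K (Q z) = Q (K z)" for z
      by (metis blinfun_apply_blinfun_compose)
    have sq: "K (K z) = Q (Q z)" for z
      using K(2) Q(2) by (metis blinfun_apply_blinfun_compose)
    define y where "y = K x - Q x"
    have "K y + Q y = 0"
      by (simp add: y_def blinfun.diff_right KQ sq)
    then have "K y \<bullet> y + Q y \<bullet> y = 0"
      by (simp flip: inner_add_left)
    then have "K y \<bullet> y = 0" "Q y \<bullet> y = 0"
      using psd_nonneg[OF K(1), of y] psd_nonneg[OF Q(1), of y] by linarith+
    then have "K y = 0" "Q y = 0" using psd_kernel K(1) Q(1) by blast+
    then have "y \<bullet> y = 0"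
      using psd_symmetric[OF K(1), of x y] psd_symmetric[OF Q(1), of x y]
      by (simp add: y_def inner_diff)
    then show "K x = Q x" by (simp add: y_def)
  qed
  from this[OF S refl] this[OF R eq[symmetric]] show ?thesis by simp
qed

section \<open>Adjoints and positive operators on complex Hilbert spaces\<close>

instance chilbert_space \<subseteq> banach ..

lemma cinner_scaleC_right: "cinner x (c *\<^sub>C y) = cnj c * cinner x y"
  by (metis cinner_commute cinner_scaleC_left complex_cnj_cnj complex_cnj_mult)

lemma cinner_add_right: "cinner x (y + z) = cinner x y + cinner x z"
  by (metis cinner_commute cinner_add_left complex_cnj_add complex_cnj_cnj)

lemma Im_cinner: "Im (cinner x y) = ((- \<i>) *\<^sub>C x) \<bullet> y"
  by (simp add: inner_eq_Re_cinner cinner_scaleC_left)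

lemma inner_scaleC_left: "(c *\<^sub>C x) \<bullet> y = x \<bullet> (cnj c *\<^sub>C y)"
  by (simp add: inner_eq_Re_cinner cinner_scaleC_left cinner_scaleC_right)

lemma bounded_linear_scaleC: "bounded_linear ((*\<^sub>C) c :: 'a::chilbert_space \<Rightarrow> 'a)"
proof (rule bounded_linear_intro[of _ "cmod c"])
  fix r and x y :: 'a
  show "c *\<^sub>C (x + y) = c *\<^sub>C x + c *\<^sub>C y" by (rule scaleC_add_right)
  show "c *\<^sub>C (r *\<^sub>R x) = r *\<^sub>R c *\<^sub>C x"
    by (simp add: scaleR_scaleC scaleC_scaleC mult.commute)
  have "(c *\<^sub>C x) \<bullet> (c *\<^sub>C x) = x \<bullet> (of_real ((cmod c)\<^sup>2) *\<^sub>C x)"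
    unfolding inner_scaleC_left scaleC_scaleC
    by (simp only: complex_norm_square mult.commute)
  then have "(norm (c *\<^sub>C x))\<^sup>2 = (norm x * cmod c)\<^sup>2"
    by (simp add: power2_norm_eq_inner power_mult_distrib flip: scaleR_scaleC)
  then show "norm (c *\<^sub>C x) \<le> norm x * cmod c" by simp
qed

lemma clinear_op_scaleC: "clinear_op A \<Longrightarrow> A (c *\<^sub>C x) = c *\<^sub>C A x"
  by (simp add: clinear_op_def)

text \<open>
  Phrased as commutation with bounded operators, complex linearity passes from a positive operator
  to its square root.
\<close>

lemma clinear_op_iff_commute:
  "clinear_op A \<longleftrightarrow> (\<forall>c. Blinfun ((*\<^sub>C) c) o\<^sub>L A = A o\<^sub>L Blinfun ((*\<^sub>C) c))"
  unfolding clinear_op_def blinfun_apply_inject[symmetric] fun_eq_iff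
  by (auto simp: bounded_linear_Blinfun_apply[OF bounded_linear_scaleC])

lemma scaleC_zero: "c *\<^sub>C (0::'a::chilbert_space) = 0"
  using bounded_linear_scaleC[THEN linear_simps(3)] .

lemma scaleC_diff: "c *\<^sub>C (x - y) = c *\<^sub>C x - c *\<^sub>C (y::'a::chilbert_space)"
  using bounded_linear_scaleC[THEN linear_simps(2)] .

lemma clinear_op_compose: "clinear_op A \<Longrightarrow> clinear_op B \<Longrightarrow> clinear_op (A o\<^sub>L B)"
  and clinear_op_add: "clinear_op A \<Longrightarrow> clinear_op B \<Longrightarrow> clinear_op (A + B)"
  and clinear_op_scaleR: "clinear_op A \<Longrightarrow> clinear_op (r *\<^sub>R A)"
  by (simp_all add: clinear_op_def blinfun.add_left blinfun.scaleR_left scaleC_add_right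
      scaleR_scaleC scaleC_scaleC mult.commute)

text \<open>
  By \<open>Im_cinner\<close> the imaginary part of \<open>cinner x y\<close> is a real inner product with \<open>x\<close>
  rotated by \<open>- \<i>\<close>, and a complex-linear \<open>A\<close> commutes with the rotation. So adjoints may be
  computed with the real inner product alone.
\<close>

lemma cinner_adjoint_of_inner:
  fixes A B :: "'a::chilbert_space \<Rightarrow>\<^sub>L 'a"
  assumes "clinear_op A" "\<And>x y. A x \<bullet> y = x \<bullet> B y"
  shows "cinner (A x) y = cinner x (B y)"
proof (rule complex_eqI)
  show "Re (cinner (A x) y) = Re (cinner x (B y))"
    using assms(2) by (simp add: inner_eq_Re_cinner)
  show "Im (cinner (A x) y) = Im (cinner x (B y))"
    unfolding Im_cinner by (simp add: assms flip: clinear_op_scaleC[OF assms(1)])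
qed

lemma adj_eqI:
  fixes A B :: "'a::chilbert_space \<Rightarrow>\<^sub>L 'a"
  assumes "clinear_op A" and AB: "\<And>x y. A x \<bullet> y = x \<bullet> B y"
  shows "adj A = B"
  unfolding adj_def
proof (rule the_equality)
  show "\<forall>x y. cinner (A x) y = cinner x (B y)"
    using cinner_adjoint_of_inner[OF assms] by blast
next
  fix C :: "'a \<Rightarrow>\<^sub>L 'a"
  assume "\<forall>x y. cinner (A x) y = cinner x (C y)"
  then have "x \<bullet> C y = A x \<bullet> y" for x y
    by (simp add: inner_eq_Re_cinner)
  then have "x \<bullet> C y = x \<bullet> B y" for x y
    by (simp add: AB)
  then show "C = B"
    by (intro blinfun_eqI) (metis vector_eq_ldot)
qed

lemma inner_adj_right:
  assumes "clinear_op A"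
  shows "A x \<bullet> y = x \<bullet> adj A y"
  using real_adjoint_exists[of A] adj_eqI[OF assms] by metis

lemma clinear_op_adj:
  assumes "clinear_op A"
  shows "clinear_op (adj A)"
  unfolding clinear_op_def
proof (intro allI)
  fix c y
  have "x \<bullet> adj A (c *\<^sub>C y) = x \<bullet> (c *\<^sub>C adj A y)" for x
    using inner_scaleC_left[of "cnj c" "A x" y] inner_scaleC_left[of "cnj c" x "adj A y"]
    by (simp add: clinear_op_scaleC[OF assms] flip: inner_adj_right[OF assms])
  then show "adj A (c *\<^sub>C y) = c *\<^sub>C adj A y" by (metis vector_eq_ldot)
qed

lemma inner_adj_left: "clinear_op A \<Longrightarrow> adj A x \<bullet> y = x \<bullet> A y"
  by (metis inner_adj_right inner_commute)

lemma adj_adj: "clinear_op A \<Longrightarrow> adj (adj A) = A"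
  by (intro adj_eqI clinear_op_adj inner_adj_left)

text \<open>
  This reduces the complex order on operators to the real one. Symmetry is a consequence of the
  complex definition, by polarization.
\<close>

lemma positive_op_iff_psd: "positive_op A \<longleftrightarrow> clinear_op A \<and> psd A"
proof safe
  assume A: "positive_op A"
  then show lin: "clinear_op A" by (simp add: positive_op_def)
  have nonneg: "cinner (A x) x \<in> \<real>\<^sub>\<ge>\<^sub>0" for x using A by (simp add: positive_op_def)
  \<comment> \<open>A sesquilinear form that vanishes on the diagonal vanishes identically.\<close>
  define h where "h x y = cinner (A x) y - cinner x (A y)" for x y
  have diag: "h x x = 0" for x
    using nonneg[of x] cinner_commute[of x "A x"]
    by (simp add: h_def complex_nonneg_Reals_iff complex_eq_iff)
  have h_add: "h (x + y) (x + y) = h x x + h x y + h y x + h y y" for x y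
    by (simp add: h_def blinfun.add_right cinner_add_left cinner_add_right)
  have h_scale: "h (c *\<^sub>C x) y = c * h x y" "h x (c *\<^sub>C y) = cnj c * h x y" for c x y
    by (simp_all add: h_def clinear_op_scaleC[OF lin] cinner_scaleC_left cinner_scaleC_right
        algebra_simps)
  have "h x y = 0" for x y
  proof -
    have "h x y + h y x = 0" using h_add[of x y] by (simp add: diag)
    moreover have "\<i> * (h x y - h y x) = 0"
      using h_add[of "\<i> *\<^sub>C x" y] by (simp add: diag h_scale algebra_simps)
    ultimately show ?thesis by simp
  qed
  then have "A x \<bullet> y = x \<bullet> A y" for x y
    by (simp add: inner_eq_Re_cinner h_def)
  moreover have "0 \<le> A x \<bullet> x" for x
    using nonneg[of x] by (simp add: inner_eq_Re_cinner complex_nonneg_Reals_iff)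
  ultimately show "psd A" by (simp add: psd_def)
next
  assume lin: "clinear_op A" and A: "psd A"
  have "cinner (A x) x \<in> \<real>\<^sub>\<ge>\<^sub>0" for x
  proof -
    have "cinner (A x) x = cnj (cinner (A x) x)"
      using cinner_adjoint_of_inner[OF lin psd_symmetric[OF A]] cinner_commute by metis
    then show ?thesis
      using psd_nonneg[OF A, of x]
      by (simp add: complex_nonneg_Reals_iff inner_eq_Re_cinner complex_eq_iff)
  qed
  then show "positive_op A" using lin by (simp add: positive_op_def)
qed

lemma positive_op_clinear: "positive_op A \<Longrightarrow> clinear_op A"
  and positive_op_symmetric: "positive_op A \<Longrightarrow> A x \<bullet> y = x \<bullet> A y"
  and positive_op_nonneg: "positive_op A \<Longrightarrow> 0 \<le> A x \<bullet> x"
  by (simp_all add: positive_op_iff_psd psd_nonneg) (simp add: psd_symmetric)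

lemma positive_opI:
  assumes "clinear_op A" "\<And>x y. A x \<bullet> y = x \<bullet> A y" "\<And>x. 0 \<le> A x \<bullet> x"
  shows "positive_op A"
  unfolding positive_op_iff_psd psd_def using assms by blast

lemma adj_positive_op: "positive_op A \<Longrightarrow> adj A = A"
  by (intro adj_eqI positive_op_clinear positive_op_symmetric)

lemma op_sqrt_eqI:
  assumes "positive_op S" "S o\<^sub>L S = A"
  shows "op_sqrt A = S"
  unfolding op_sqrt_def
  using assms psd_sqrt_unique by (intro the_equality) (auto simp: positive_op_iff_psd)

lemma op_sqrt_positive:
  assumes "positive_op A"
  shows "positive_op (op_sqrt A)" "op_sqrt A o\<^sub>L op_sqrt A = A"
proof -
  from assms have "psd A" by (simp add: positive_op_iff_psd)
  then obtain S where S: "psd S" "S o\<^sub>L S = A"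
    and comm: "\<And>C. C o\<^sub>L A = A o\<^sub>L C \<Longrightarrow> C o\<^sub>L S = S o\<^sub>L C"
    by (rule psd_sqrt_exists) blast
  have "clinear_op S"
    using positive_op_clinear[OF assms] comm by (simp add: clinear_op_iff_commute)
  then have "positive_op S" using S by (simp add: positive_op_iff_psd)
  with S(2) show "positive_op (op_sqrt A)" "op_sqrt A o\<^sub>L op_sqrt A = A"
    using op_sqrt_eqI[OF \<open>positive_op S\<close> S(2)] by simp_all
qed

lemma positive_op_conjugate:
  assumes A: "positive_op A" and C: "clinear_op C"
  shows "positive_op (adj C o\<^sub>L A o\<^sub>L C)"
proof -
  have "adj C (A (C x)) \<bullet> y = x \<bullet> adj C (A (C y))" for x y
    using A C by (simp add: inner_adj_left positive_op_symmetric flip: inner_adj_right)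
  moreover have "0 \<le> adj C (A (C x)) \<bullet> x" for x
    using positive_op_nonneg[OF A, of "C x"] C by (simp add: inner_adj_left)
  ultimately show ?thesis
    using A C by (simp add: positive_op_iff_psd psd_def clinear_op_compose clinear_op_adj)
qed

lemma positive_op_gram: "clinear_op C \<Longrightarrow> positive_op (adj C o\<^sub>L C)"
  by (simp add: positive_op_iff_psd psd_def inner_adj_left clinear_op_compose clinear_op_adj
      flip: inner_adj_right)

lemma positive_op_add: "positive_op A \<Longrightarrow> positive_op B \<Longrightarrow> positive_op (A + B)"
  by (rule positive_opI)
    (simp_all add: positive_op_clinear positive_op_symmetric positive_op_nonneg clinear_op_add
      blinfun.add_left inner_add add_nonneg_nonneg flip: positive_op_symmetric)

lemma positive_op_scaleR: "positive_op A \<Longrightarrow> 0 \<le> r \<Longrightarrow> positive_op (r *\<^sub>R A)"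
  by (rule positive_opI)
    (simp_all add: positive_op_clinear positive_op_nonneg clinear_op_scaleR
      blinfun.scaleR_left, simp add: positive_op_symmetric)

lemma op_le_trans: "A \<preceq> B \<Longrightarrow> B \<preceq> C \<Longrightarrow> A \<preceq> C"
  using positive_op_add[of "B - A" "C - B"] by (simp add: op_le_def)

lemma op_le_conjugate:
  assumes "A \<preceq> B" "clinear_op C"
  shows "adj C o\<^sub>L A o\<^sub>L C \<preceq> adj C o\<^sub>L B o\<^sub>L C"
proof -
  have "(adj C o\<^sub>L B o\<^sub>L C) - (adj C o\<^sub>L A o\<^sub>L C) = adj C o\<^sub>L (B - A) o\<^sub>L C"
    by (rule blinfun_eqI) (simp add: blinfun.diff_left blinfun.diff_right)
  then show ?thesis
    using positive_op_conjugate assms by (simp add: op_le_def)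
qed

lemma semi_co_hyponormal_iff:
  assumes "positive_op S" "S o\<^sub>L S = adj A o\<^sub>L A" "positive_op R" "R o\<^sub>L R = A o\<^sub>L adj A"
  shows "semi_co_hyponormal A \<longleftrightarrow> S \<preceq> R"
  unfolding semi_co_hyponormal_def using assms by (simp add: op_sqrt_eqI)

section \<open>The identities between the moduli\<close>

text \<open>
  The range of \<open>P\<close> lies in the initial space of \<open>V\<close>, and, by \<open>final_right\<close> and its adjoint
  \<open>final\<close>, also in the final space of \<open>V\<close>. The computation of the moduli needs nothing else
  of a polar decomposition.
\<close>

locale polar_factors =
  fixes P V :: "'a::chilbert_space \<Rightarrow>\<^sub>L 'a"
  assumes P: "positive_op P" and V: "clinear_op V"
    and initial: "adj V (V (P x)) = P x"
    and final_right: "P (V (adj V x)) = P x"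
begin

abbreviation Q where "Q \<equiv> adj V o\<^sub>L P o\<^sub>L V"
abbreviation R where "R \<equiv> V o\<^sub>L P o\<^sub>L adj V"

lemmas transpose = positive_op_symmetric[OF P] inner_adj_left[OF V] inner_adj_right[OF V]

lemma initial_right: "P (adj V (V x)) = P x"
proof -
  have "P (adj V (V x)) \<bullet> y = P x \<bullet> y" for y by (simp add: transpose initial)
  then show ?thesis by (metis vector_eq_rdot)
qed

lemma final: "V (adj V (P x)) = P x"
proof -
  have "V (adj V (P x)) \<bullet> y = P x \<bullet> y" for y by (simp add: transpose final_right)
  then show ?thesis by (metis vector_eq_rdot)
qed

lemmas cancel = initial initial_right final final_right
lemmas clinear = clinear_op_compose clinear_op_add clinear_op_scaleR clinear_op_adj V
  positive_op_clinear[OF P]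
lemmas expand = blinfun.add_left blinfun.scaleR_left blinfun.add_right blinfun.scaleR_right
  blinfun.diff_left blinfun.diff_right

lemma Q_positive: "positive_op Q" and R_positive: "positive_op R"
  using positive_op_conjugate[OF P V] positive_op_conjugate[OF P clinear_op_adj[OF V]]
  by (simp_all add: adj_adj[OF V])

text \<open>
  For the operator \<open>V P\<close> and for its Duggal and mean transforms, the moduli of the operator
  and of its adjoint can be written down explicitly: their squares are computed by cancelling
  \<open>V\<close> against \<open>adj V\<close> next to \<open>P\<close>, and positive square roots are
  unique. Here \<open>V P\<close> has the moduli \<open>P\<close> and \<open>R\<close>.
\<close>

lemma semi_co_hyponormal_factors: "semi_co_hyponormal (V o\<^sub>L P) \<longleftrightarrow> P \<preceq> R"
proof -
  have adj: "adj (V o\<^sub>L P) = P o\<^sub>L adj V"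
    by (intro adj_eqI clinear) (simp add: transpose)
  show ?thesis
    by (intro semi_co_hyponormal_iff P R_positive blinfun_eqI) (simp_all add: adj cancel)
qed

text \<open>The moduli of \<open>P V\<close> and of its adjoint are \<open>Q\<close> and \<open>P\<close>.\<close>

lemma semi_co_hyponormal_duggal: "semi_co_hyponormal (P o\<^sub>L V) \<longleftrightarrow> Q \<preceq> P"
proof -
  have adj: "adj (P o\<^sub>L V) = adj V o\<^sub>L P"
    by (intro adj_eqI clinear) (simp add: transpose)
  show ?thesis
    by (intro semi_co_hyponormal_iff P Q_positive blinfun_eqI) (simp_all add: adj cancel)
qed

text \<open>
  With \<open>A = V P + P V\<close>, the mixed terms of \<open>A\<^sup>* A\<close> are \<open>P Q\<close> and \<open>Q P\<close>, and those of
  \<open>A A\<^sup>*\<close> are \<open>P R\<close> and \<open>R P\<close>; hence the moduli of \<open>A\<close> and \<open>A\<^sup>*\<close> are the sums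
  \<open>P + Q\<close> and \<open>P + R\<close> of the moduli of its two summands; the common \<open>P\<close> then drops out of the
  comparison.
\<close>

lemma semi_co_hyponormal_mean:
  "semi_co_hyponormal ((1/2) *\<^sub>R ((V o\<^sub>L P) + (P o\<^sub>L V))) \<longleftrightarrow> Q \<preceq> R"
proof -
  let ?M = "(1/2) *\<^sub>R ((V o\<^sub>L P) + (P o\<^sub>L V))"
  have adj: "adj ?M = (1/2) *\<^sub>R ((P o\<^sub>L adj V) + (adj V o\<^sub>L P))"
    by (intro adj_eqI clinear) (simp add: transpose expand inner_add)
  have "semi_co_hyponormal ?M \<longleftrightarrow> (1/2) *\<^sub>R (P + Q) \<preceq> (1/2) *\<^sub>R (P + R)"
  proof (intro semi_co_hyponormal_iff positive_op_scaleR positive_op_add P Q_positive R_positive)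
    show "(1/2) *\<^sub>R (P + Q) o\<^sub>L (1/2) *\<^sub>R (P + Q) = adj ?M o\<^sub>L ?M"
      "(1/2) *\<^sub>R (P + R) o\<^sub>L (1/2) *\<^sub>R (P + R) = ?M o\<^sub>L adj ?M"
      unfolding adj by (rule blinfun_eqI; simp add: cancel expand algebra_simps)+
  qed simp_all
  moreover have "(1/2) *\<^sub>R (P + R) - (1/2) *\<^sub>R (P + Q) = (1/2) *\<^sub>R (R - Q)"
    by (simp add: algebra_simps)
  moreover have "positive_op ((1/2) *\<^sub>R (R - Q)) \<longleftrightarrow> positive_op (R - Q)"
    using positive_op_scaleR[of "R - Q" "1/2"] positive_op_scaleR[of "(1/2) *\<^sub>R (R - Q)" 2]
    by auto
  ultimately show ?thesis by (simp add: op_le_def)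
qed

text \<open>
  Conjugation by \<open>V\<close> takes the pair \<open>P\<close>, \<open>R\<close> to \<open>Q\<close>, \<open>P\<close>, and conjugation by
  \<open>adj V\<close> takes it back.
\<close>

lemma op_le_R_iff: "P \<preceq> R \<longleftrightarrow> Q \<preceq> P"
proof
  have "adj V o\<^sub>L R o\<^sub>L V = P" by (rule blinfun_eqI) (simp add: cancel)
  then show "Q \<preceq> P" if "P \<preceq> R" using op_le_conjugate[OF that V] by simp
next
  have "V o\<^sub>L Q o\<^sub>L adj V = P" by (rule blinfun_eqI) (simp add: cancel)
  then show "P \<preceq> R" if "Q \<preceq> P"
    using op_le_conjugate[OF that clinear_op_adj[OF V]] by (simp add: adj_adj[OF V])
qed

abbreviation S where "S \<equiv> op_sqrt P"

lemma S_positive: "positive_op S"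
  by (rule op_sqrt_positive[OF P])

lemma S_S: "S (S x) = P x"
  using op_sqrt_positive(2)[OF P] by (metis blinfun_apply_blinfun_compose)

lemma co_hyponormal_aluthge:
  "co_hyponormal (S o\<^sub>L V o\<^sub>L S) \<longleftrightarrow> S o\<^sub>L Q o\<^sub>L S \<preceq> S o\<^sub>L R o\<^sub>L S"
proof -
  have adj: "adj (S o\<^sub>L V o\<^sub>L S) = S o\<^sub>L adj V o\<^sub>L S"
    by (intro adj_eqI clinear positive_op_clinear S_positive)
      (simp add: positive_op_symmetric[OF S_positive] transpose)
  have "adj (S o\<^sub>L V o\<^sub>L S) o\<^sub>L (S o\<^sub>L V o\<^sub>L S) = S o\<^sub>L Q o\<^sub>L S"
    "(S o\<^sub>L V o\<^sub>L S) o\<^sub>L adj (S o\<^sub>L V o\<^sub>L S) = S o\<^sub>L R o\<^sub>L S"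
    by (rule blinfun_eqI; simp add: adj S_S)+
  then show ?thesis by (simp add: co_hyponormal_def)
qed

lemma co_hyponormal_aluthgeI: "Q \<preceq> R \<Longrightarrow> co_hyponormal (S o\<^sub>L V o\<^sub>L S)"
  using op_le_conjugate[of Q R S] S_positive
  by (simp add: co_hyponormal_aluthge adj_positive_op positive_op_clinear)

text \<open>
  The hypothesis on the Aluthge transform compares the forms of \<open>Q\<close> and \<open>R\<close> on the range of
  \<open>S\<close>, and by continuity on its closure. The orthogonal complement of the range is the kernel
  of \<open>S\<close>, which is that of \<open>P\<close>; there both \<open>Q\<close> and \<open>R\<close> vanish, because the
  kernel hypothesis makes \<open>V\<close> and \<open>adj V\<close> vanish.
\<close>

lemma co_hyponormal_aluthgeD:
  assumes ker: "\<And>z. P z = 0 \<Longrightarrow> V z = 0 \<and> adj V z = 0"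
    and aluthge: "co_hyponormal (S o\<^sub>L V o\<^sub>L S)"
  shows "Q \<preceq> R"
proof -
  define D where "D = R - Q"
  have D: "clinear_op D" "D x \<bullet> y = x \<bullet> D y" for x y
    unfolding D_def using Q_positive R_positive
    by (auto simp: clinear_op_def positive_op_iff_psd psd_def expand scaleC_diff inner_diff)
  have D_ker: "D z = 0" if "P z = 0" for z
    using ker[OF that] by (simp add: D_def expand)
  have on_range: "0 \<le> D (S x) \<bullet> S x" for x
  proof -
    have "positive_op ((S o\<^sub>L R o\<^sub>L S) - (S o\<^sub>L Q o\<^sub>L S))"
      using aluthge by (simp add: co_hyponormal_aluthge op_le_def)
    from positive_op_nonneg[OF this, of x] show ?thesis
      by (simp add: D_def expand inner_diff positive_op_symmetric[OF S_positive])
  qed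
  let ?N = "closure (range S)"
  have "subspace (range S)"
    by (intro linear_subspace_image bounded_linear.linear blinfun.bounded_linear_right subspace_UNIV)
  then have N: "subspace ?N" "closed ?N" by (auto intro: subspace_closure)
  have on_closure: "0 \<le> D u \<bullet> u" if "u \<in> ?N" for u
  proof -
    from that obtain X where X: "\<And>n. X n \<in> range S" "X \<longlonglongrightarrow> u"
      unfolding closure_sequential by blast
    then have "(\<lambda>n. D (X n) \<bullet> X n) \<longlonglongrightarrow> D u \<bullet> u" by (intro tendsto_intros)
    moreover have "0 \<le> D (X n) \<bullet> X n" for n using X(1)[of n] on_range by auto
    ultimately show ?thesis using LIMSEQ_le_const by blast
  qed
  have "0 \<le> D x \<bullet> x" for x
  proof -
    obtain u w where x: "x = u + w" "u \<in> ?N" and w: "\<And>y. y \<in> ?N \<Longrightarrow> w \<bullet> y = 0"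
      using orthogonal_projection_exists[OF N] by metis
    have "S w \<bullet> y = 0" for y
      using w[of "S y"] closure_subset[of "range S"]
      by (simp add: positive_op_symmetric[OF S_positive] subset_iff)
    then have "S w = 0" using inner_eq_zero_iff by blast
    then have "P w = 0" by (metis S_S blinfun.zero_right)
    then have "D x \<bullet> x = D u \<bullet> u"
      using D(2)[of u w] D_ker by (simp add: x blinfun.add_right inner_add)
    then show ?thesis using on_closure[OF x(2)] by simp
  qed
  then show ?thesis
    using D by (simp add: op_le_def positive_op_iff_psd psd_def flip: D_def)
qed

end

section \<open>The polar decomposition\<close>

text \<open>
  Being isometric on the complement of its kernel, \<open>V\<close> preserves inner products there. Splitting
  an arbitrary test vector along the kernel and its complement gives the claim.
\<close>

lemma partial_isometry_adj_cancel:
  assumes V: "partial_isometry V" and x: "\<And>z. z \<in> op_ker V \<Longrightarrow> cinner x z = 0"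
  shows "adj V (V x) = x"
proof -
  have lin: "clinear_op V" using V by (simp add: partial_isometry_def)
  have iso: "norm (V y) = norm y" if "\<And>z. z \<in> op_ker V \<Longrightarrow> cinner y z = 0" for y
    using V that by (simp add: partial_isometry_def)
  let ?N = "op_ker V"
  have N: "subspace ?N" "closed ?N"
  proof -
    show "subspace ?N"
      by (simp add: op_ker_def subspace_def blinfun.add_right blinfun.scaleR_right)
    have "?N = V -` {0}" by (auto simp: op_ker_def)
    moreover have "closed (V -` {0})"
      by (intro continuous_closed_vimage) (auto intro!: continuous_intros)
    ultimately show "closed ?N" by simp
  qed
  have "adj V (V x) \<bullet> y = x \<bullet> y" for y
  proof -
    obtain u w where y: "y = u + w" and u: "u \<in> ?N" and w: "\<And>z. z \<in> ?N \<Longrightarrow> w \<bullet> z = 0"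
      using orthogonal_projection_exists[OF N] by metis
    have w': "cinner w z = 0" if z: "z \<in> ?N" for z
    proof (rule complex_eqI)
      show "Re (cinner w z) = Re 0" using w[OF z] by (simp add: inner_eq_Re_cinner)
      have "\<i> *\<^sub>C z \<in> ?N"
        using z by (simp add: op_ker_def clinear_op_scaleC[OF lin] scaleC_zero)
      from w[OF this] show "Im (cinner w z) = Im 0"
        by (simp add: Im_cinner inner_scaleC_left)
    qed
    have "V x \<bullet> V w = x \<bullet> w"
      using iso[OF x] iso[OF w'] iso[of "x + w"]
      by (simp add: dot_norm cinner_add_left x w' flip: blinfun.add_right)
    moreover have "V u = 0" using u by (simp add: op_ker_def)
    moreover have "x \<bullet> u = 0" using x[OF u] by (simp add: inner_eq_Re_cinner)
    ultimately show ?thesis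
      by (simp add: inner_adj_left[OF lin] y blinfun.add_right inner_add)
  qed
  then show ?thesis by (metis vector_eq_rdot)
qed

lemma op_abs_positive:
  assumes "clinear_op T"
  shows "positive_op (op_abs T)" "op_abs T o\<^sub>L op_abs T = adj T o\<^sub>L T"
  unfolding op_abs_def using op_sqrt_positive[OF positive_op_gram[OF assms]] by auto

lemma op_ker_op_abs:
  assumes "clinear_op T"
  shows "op_ker (op_abs T) = op_ker T"
proof -
  note P = op_abs_positive[OF assms]
  have "op_abs T x \<bullet> op_abs T x = T x \<bullet> T x" for x
  proof -
    have "op_abs T (op_abs T x) = adj T (T x)" using P(2) by (metis blinfun_apply_blinfun_compose)
    then show ?thesis
      by (metis P(1) assms inner_adj_left inner_commute positive_op_symmetric)
  qed
  then show ?thesis unfolding op_ker_def by (metis inner_eq_zero_iff)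
qed

text \<open>
  The cancellation \<open>V\<^sup>* V P = P\<close> holds since the range of \<open>P\<close> is orthogonal to the kernel
  of \<open>P\<close>, which is that of \<open>V\<close>. Likewise \<open>V\<^sup>* V V\<^sup>* = V\<^sup>*\<close>, so
  \<open>V V\<^sup>* y - y\<close> is in the kernel of \<open>V\<^sup>*\<close>, hence in that of \<open>T\<^sup>* = P V\<^sup>*\<close>; the inclusion
  of the kernels puts it into the kernel of \<open>P\<close>, which is \<open>P V V\<^sup>* = P\<close>.
\<close>

lemma
  fixes T V :: "'a::chilbert_space \<Rightarrow>\<^sub>L 'a"
  assumes T: "clinear_op T" and polar: "polar_decomposition T V"
    and ker: "op_ker (adj T) \<subseteq> op_ker T"
  shows polar_factors_polar_decomposition: "polar_factors (op_abs T) V"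
    and kernels_polar_decomposition:
      "op_ker (adj T) = op_ker T \<Longrightarrow> op_abs T z = 0 \<Longrightarrow> V z = 0 \<and> adj V z = 0"
proof -
  let ?P = "op_abs T"
  note P = op_abs_positive(1)[OF T]
  have iso: "partial_isometry V" and T_eq: "T = V o\<^sub>L ?P" and kerV: "op_ker V = op_ker T"
    using polar by (auto simp: polar_decomposition_def)
  have V: "clinear_op V" using iso by (simp add: partial_isometry_def)
  have kerP: "op_ker ?P = op_ker V" using op_ker_op_abs[OF T] kerV by simp
  have initial: "adj V (V (?P x)) = ?P x" for x
  proof (rule partial_isometry_adj_cancel[OF iso])
    fix z assume "z \<in> op_ker V"
    then have "?P z = 0" using kerP by (auto simp: op_ker_def)
    then show "cinner (?P x) z = 0"
      using cinner_adjoint_of_inner[OF positive_op_clinear[OF P] positive_op_symmetric[OF P], of x z]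
        cinner_scaleC_right[of x 0 0] by (simp add: scaleC_zero)
  qed
  have coinitial: "adj V (V (adj V x)) = adj V x" for x
  proof (rule partial_isometry_adj_cancel[OF iso])
    fix z assume "z \<in> op_ker V"
    then have "V z = 0" by (auto simp: op_ker_def)
    then show "cinner (adj V x) z = 0"
      using cinner_adjoint_of_inner[OF clinear_op_adj[OF V] inner_adj_left[OF V], of x z]
        cinner_scaleC_right[of x 0 0] by (simp add: scaleC_zero)
  qed
  have adjT: "adj T = ?P o\<^sub>L adj V"
    unfolding T_eq[symmetric]
    by (intro adj_eqI T, subst T_eq) (simp add: positive_op_symmetric[OF P] inner_adj_right[OF V])
  have final_right: "?P (V (adj V y)) = ?P y" for y
  proof -
    have "adj V (V (adj V y) - y) = 0" by (simp add: blinfun.diff_right coinitial)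
    then have "V (adj V y) - y \<in> op_ker (adj T)" by (simp add: op_ker_def adjT)
    then have "V (adj V y) - y \<in> op_ker ?P" using ker kerP kerV by blast
    then show ?thesis by (simp add: op_ker_def blinfun.diff_right)
  qed
  show "polar_factors ?P V" by unfold_locales (fact P V initial final_right)+
  show "V z = 0 \<and> adj V z = 0" if eq: "op_ker (adj T) = op_ker T" and z: "?P z = 0"
  proof
    from z have "z \<in> op_ker ?P" by (simp add: op_ker_def)
    then have "z \<in> op_ker V" "z \<in> op_ker (adj T)" using kerP kerV eq by auto
    then show "V z = 0" by (simp add: op_ker_def)
    from \<open>z \<in> op_ker (adj T)\<close> have "adj V z \<in> op_ker ?P" by (simp add: op_ker_def adjT)
    then have "V (adj V z) = 0" unfolding kerP by (simp add: op_ker_def)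
    then show "adj V z = 0" using coinitial[of z] by simp
  qed
qed

section \<open>The equivalences and implications\<close>

theorem theorem2p7:
  fixes T V :: "'a::chilbert_space \<Rightarrow>\<^sub>L 'a"
  assumes "clinear_op T"
    and "polar_decomposition T V"
    and "op_ker (adj T) \<subseteq> op_ker T"
  shows
    "(semi_co_hyponormal T \<longleftrightarrow>
        op_abs T \<preceq> V o\<^sub>L op_abs T o\<^sub>L adj V \<and> adj V o\<^sub>L op_abs T o\<^sub>L V \<preceq> op_abs T)
     \<and> (op_abs T \<preceq> V o\<^sub>L op_abs T o\<^sub>L adj V \<and> adj V o\<^sub>L op_abs T o\<^sub>L V \<preceq> op_abs T \<longleftrightarrow>
        semi_co_hyponormal (duggal_transform T V))
     \<and> (semi_co_hyponormal (duggal_transform T V) \<longrightarrow>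
        semi_co_hyponormal (mean_transform T V))
     \<and> (semi_co_hyponormal (mean_transform T V) \<longleftrightarrow>
        adj V o\<^sub>L op_abs T o\<^sub>L V \<preceq> V o\<^sub>L op_abs T o\<^sub>L adj V)
     \<and> (adj V o\<^sub>L op_abs T o\<^sub>L V \<preceq> V o\<^sub>L op_abs T o\<^sub>L adj V \<longrightarrow>
        co_hyponormal (aluthge_transform T V))
     \<and> (op_ker (adj T) = op_ker T \<longrightarrow>
        co_hyponormal (aluthge_transform T V) \<longrightarrow>
        adj V o\<^sub>L op_abs T o\<^sub>L V \<preceq> V o\<^sub>L op_abs T o\<^sub>L adj V)"
proof -
  interpret polar_factors "op_abs T" V
    using polar_factors_polar_decomposition[OF assms] .
  have T_eq: "T = V o\<^sub>L op_abs T" using assms(2) by (simp add: polar_decomposition_def)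
  have mean: "mean_transform T V = (1/2) *\<^sub>R ((V o\<^sub>L op_abs T) + (op_abs T o\<^sub>L V))"
    unfolding mean_transform_def using T_eq by simp
  have "semi_co_hyponormal T \<longleftrightarrow> op_abs T \<preceq> R"
    using semi_co_hyponormal_factors T_eq by simp
  moreover have "semi_co_hyponormal (duggal_transform T V) \<longleftrightarrow> Q \<preceq> op_abs T"
    using semi_co_hyponormal_duggal by (simp add: duggal_transform_def)
  moreover have "semi_co_hyponormal (mean_transform T V) \<longleftrightarrow> Q \<preceq> R"
    using semi_co_hyponormal_mean by (simp add: mean)
  moreover have "op_ker (adj T) = op_ker T \<longrightarrow> co_hyponormal (aluthge_transform T V) \<longrightarrow> Q \<preceq> R"
    using co_hyponormal_aluthgeD kernels_polar_decomposition[OF assms]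
    by (simp add: aluthge_transform_def)
  moreover have "Q \<preceq> R \<longrightarrow> co_hyponormal (aluthge_transform T V)"
    using co_hyponormal_aluthgeI by (simp add: aluthge_transform_def)
  ultimately show ?thesis
    using op_le_R_iff op_le_trans[of Q "op_abs T" R] by blast
qed

end
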